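(* For every positive integer $k$ there exists a quadrangulation $Q_k$ with $n = 4k+2$ vertices such that the minimum size of an edge guard set of $Q_k$ is exactly $k = (n-2)/4$.
   Context: A plane graph is a simple graph together with a crossing-free embedding in $\mathbb{R}^2$ (edges need not be straight). A quadrangulation is a plane graph in which every face (including the outer face) is bounded by a $4$-cycle. For a plane graph $G=(V,E)$, a face $f$ is guarded by an edge $vw \in E$ if at least one of $v,w$ lies on the boundary of $f$. A set $\Gamma \subseteq E$ is an edge guard set if every face of $G$ (including the outer face) is guarded by some edge of $\Gamma$, i.e. every face has a boundary vertex that is an endpoint of some edge of $\Gamma$. *)

theory Defs
  imports "HOL-Analysis.Analysis"
begin

locale simple_graph =
  fixes V :: "'a set" and E :: "'a set set"
  assumes finite_vertices: "finite V"
    and edge_subset: "e \<in> E \<Longrightarrow> e \<subseteq> V"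
    and edge_card: "e \<in> E \<Longrightarrow> card e = 2"
begin

definition four_cycle :: "'a \<Rightarrow> 'a \<Rightarrow> 'a \<Rightarrow> 'a \<Rightarrow> bool" where
  "four_cycle a b c d \<longleftrightarrow>
     distinct [a, b, c, d] \<and> {a, b} \<in> E \<and> {b, c} \<in> E \<and> {c, d} \<in> E \<and> {d, a} \<in> E"

end

text \<open>
  A crossing-free embedding: \<open>pos\<close> places the vertices and \<open>crv\<close> draws every edge as a simple
  (not necessarily straight) arc between its ends. The arc parametrisation fixes an orientation of
  each edge, which plays no role. The values of \<open>pos\<close> outside \<open>V\<close> and of \<open>crv\<close> outside \<open>E\<close> are
  irrelevant.
\<close>

locale plane_graph = simple_graph V E
  for V :: "'a set" and E :: "'a set set" +
  fixes pos :: "'a \<Rightarrow> real ^ 2" and crv :: "'a set \<Rightarrow> real \<Rightarrow> real ^ 2"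
  assumes inj_pos: "inj_on pos V"
    and arc_crv: "e \<in> E \<Longrightarrow> arc (crv e)"
    and ends_crv: "e \<in> E \<Longrightarrow> {pathstart (crv e), pathfinish (crv e)} = pos ` e"
    and crv_avoids_vertices: "e \<in> E \<Longrightarrow> path_image (crv e) \<inter> pos ` V = pos ` e"
    and crossing_free: "e \<in> E \<Longrightarrow> e' \<in> E \<Longrightarrow> e \<noteq> e' \<Longrightarrow>
      path_image (crv e) \<inter> path_image (crv e') \<subseteq> pos ` (e \<inter> e')"
begin

definition drawing :: "(real ^ 2) set" where
  "drawing = pos ` V \<union> (\<Union>e\<in>E. path_image (crv e))"

text \<open>The unbounded component, i.e. the outer face, is one of the faces.\<close>

definition faces :: "(real ^ 2) set set" where
  "faces = components (- drawing)"

definition bounded_by_four_cycle :: "(real ^ 2) set \<Rightarrow> bool" where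
  "bounded_by_four_cycle f \<longleftrightarrow> (\<exists>a b c d. four_cycle a b c d \<and>
     frontier f = path_image (crv {a, b}) \<union> path_image (crv {b, c}) \<union>
                  path_image (crv {c, d}) \<union> path_image (crv {d, a}))"

definition guards :: "'a set \<Rightarrow> (real ^ 2) set \<Rightarrow> bool" where
  "guards e f \<longleftrightarrow> (\<exists>v\<in>e. pos v \<in> frontier f)"

definition edge_guard_set :: "'a set set \<Rightarrow> bool" where
  "edge_guard_set \<Gamma> \<longleftrightarrow> \<Gamma> \<subseteq> E \<and> (\<forall>f\<in>faces. \<exists>e\<in>\<Gamma>. guards e f)"

end

locale quadrangulation = plane_graph V E pos crv
  for V :: "'a set" and E :: "'a set set"
    and pos :: "'a \<Rightarrow> real ^ 2" and crv :: "'a set \<Rightarrow> real \<Rightarrow> real ^ 2" +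
  assumes faces_bounded_by_four_cycle: "f \<in> faces \<Longrightarrow> bounded_by_four_cycle f"

end

theory Submission
  imports Defs
begin

text \<open>
  Take two poles \<open>s = (0, 1)\<close> and \<open>t = (0, -1)\<close>, both joined to each of the points
  \<open>p\<^sub>j = (j, 0)\<close>, \<open>j < 2k\<close>, and for every \<open>i < k\<close> join \<open>p\<^sub>2\<^sub>i\<close> and \<open>p\<^sub>2\<^sub>i\<^sub>+\<^sub>1\<close> by two paths of
  length two whose midpoints lie above and below the segment between them. These two paths bound
  a face whose vertices all belong to the \<open>i\<close>-th gadget. No edge joins two gadgets, so these \<open>k\<close>
  faces need \<open>k\<close> different guards; on the other hand the \<open>k\<close> edges \<open>s p\<^sub>2\<^sub>i\<close> guard everything.

  The drawing is the image, under \<open>(u, y) \<mapsto> (u (1 - \<bar>y\<bar>), y)\<close>, of straight segments in a horizontal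
  strip. In the coordinates \<open>(u, y)\<close> the bounded faces are regions between two graphs over
  \<open>(j, j + 1)\<close>, which makes their frontiers explicit.
\<close>

section \<open>Regions between two graphs\<close>

text \<open>A connected set containing \<open>X\<close> cannot also meet the union of the other
  members, which is open and disjoint from \<open>X\<close>; so each member is maximal. This turns
  an explicit list of regions into the set of faces.\<close>

lemma components_open_partition:
  fixes \<A> :: "'a::topological_space set set"
  assumes "\<Union>\<A> = S"
    and op: "\<And>X. X \<in> \<A> \<Longrightarrow> open X" and con: "\<And>X. X \<in> \<A> \<Longrightarrow> connected X"
    and ne: "\<And>X. X \<in> \<A> \<Longrightarrow> X \<noteq> {}"
    and disj: "\<And>X Y. X \<in> \<A> \<Longrightarrow> Y \<in> \<A> \<Longrightarrow> X \<noteq> Y \<Longrightarrow> X \<inter> Y = {}"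
  shows "components S = \<A>"
proof -
  have sub: "X \<in> components S" if X: "X \<in> \<A>" for X
    unfolding in_components_maximal
  proof (intro conjI allI impI)
    fix d assume d: "d \<noteq> {} \<and> X \<subseteq> d \<and> d \<subseteq> S \<and> connected d"
    have "X \<inter> \<Union>(\<A> - {X}) = {}"
      using disj[OF X] by blast
    moreover have cover: "d \<subseteq> X \<union> \<Union>(\<A> - {X})"
      using d assms(1) by blast
    ultimately have "X \<inter> d = {} \<or> \<Union>(\<A> - {X}) \<inter> d = {}"
      using connectedD[of d X "\<Union>(\<A> - {X})"] d op X by auto
    moreover have "X \<inter> d \<noteq> {}"
      using d ne[OF X] by auto
    ultimately have "\<Union>(\<A> - {X}) \<inter> d = {}"
      by simp
    with cover have "d \<subseteq> X" by auto
    with d show "d = X" by auto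
  qed (use X ne con assms(1) in auto)
  have "C \<in> \<A>" if C: "C \<in> components S" for C
  proof -
    obtain x where x: "x \<in> C" "x \<in> S"
      using in_components_nonempty[OF C] in_components_subset[OF C] by blast
    then obtain X where "X \<in> \<A>" "x \<in> X"
      using assms(1) by blast
    then show ?thesis
      using components_eq[OF C sub] x by blast
  qed
  with sub show ?thesis by blast
qed

text \<open>Each of the lines \<open>y = 1\<close> and \<open>y = -1\<close> collapses to a point, a pole; for \<open>\<bar>y\<bar> < 1\<close> the map is injective.\<close>

definition Phi :: "real \<times> real \<Rightarrow> real ^ 2" where
  "Phi p = (fst p * (1 - \<bar>snd p\<bar>)) *\<^sub>R axis 1 1 + snd p *\<^sub>R axis 2 1"

lemma Phi_nth [simp]: "Phi p $ 1 = fst p * (1 - \<bar>snd p\<bar>)" "Phi p $ 2 = snd p"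
  by (simp_all add: Phi_def axis_def)

lemma continuous_on_Phi [continuous_intros]:
  "continuous_on S f \<Longrightarrow> continuous_on S (\<lambda>x. Phi (f x))"
  unfolding Phi_def by (intro continuous_intros)

lemma Phi_eq_iff: "Phi (u, y) = Phi (u', y') \<longleftrightarrow> y = y' \<and> (u = u' \<or> \<bar>y\<bar> = 1)"
  by (auto simp: vec_eq_iff forall_2)

section \<open>Cells and their frontiers\<close>

definition cell :: "real \<Rightarrow> real \<Rightarrow> (real \<Rightarrow> real) \<Rightarrow> (real \<Rightarrow> real) \<Rightarrow> (real \<times> real) set" where
  "cell l r f g = {(u, y). l < u \<and> u < r \<and> f u < y \<and> y < g u}"

definition cell_rim :: "real \<Rightarrow> real \<Rightarrow> (real \<Rightarrow> real) \<Rightarrow> (real \<Rightarrow> real) \<Rightarrow> (real \<times> real) set" where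
  "cell_rim l r f g = {(u, y). l \<le> u \<and> u \<le> r \<and> f u \<le> y \<and> y \<le> g u \<and>
     (u = l \<or> u = r \<or> y = f u \<or> y = g u)}"

text \<open>The graphs may touch at the two ends, as tents do, and may reach height 1 or -1, where
  \<open>Phi\<close> collapses them to a pole.\<close>

locale strip_cell =
  fixes l r :: real and f g :: "real \<Rightarrow> real"
  assumes l_less_r: "l < r"
    and cont: "continuous_on {l..r} f" "continuous_on {l..r} g"
    and bounds: "\<And>u. l \<le> u \<Longrightarrow> u \<le> r \<Longrightarrow> - 1 \<le> f u \<and> f u \<le> g u \<and> g u \<le> 1"
    and less: "\<And>u. l < u \<Longrightarrow> u < r \<Longrightarrow> f u < g u"
begin

text \<open>Here \<open>t\<close> is the relative height between the two graphs, so that the open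
  rectangle parametrises the cell and the closed one adds the rim.\<close>

definition chart :: "real \<times> real \<Rightarrow> real ^ 2" where
  "chart = (\<lambda>(u, t). Phi (u, f u + t * (g u - f u)))"

lemma continuous_on_chart: "continuous_on ({l..r} \<times> {0..1}) chart"
proof -
  have "continuous_on ({l..r} \<times> {0..1::real}) (\<lambda>x. f (fst x))"
       "continuous_on ({l..r} \<times> {0..1::real}) (\<lambda>x. g (fst x))"
    by (auto intro!: continuous_on_compose2[OF cont(1)] continuous_on_compose2[OF cont(2)] continuous_intros)
  then show ?thesis
    unfolding chart_def case_prod_beta by (intro continuous_intros)
qed

lemma Phi_cell: "Phi ` cell l r f g = chart ` ({l<..<r} \<times> {0<..<1})"
proof -
  have "(u, y) \<in> cell l r f g \<longleftrightarrow>
      (\<exists>t. l < u \<and> u < r \<and> 0 < t \<and> t < 1 \<and> y = f u + t * (g u - f u))" for u y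
  proof
    assume "(u, y) \<in> cell l r f g"
    then show "\<exists>t. l < u \<and> u < r \<and> 0 < t \<and> t < 1 \<and> y = f u + t * (g u - f u)"
      by (intro exI[of _ "(y - f u) / (g u - f u)"]) (auto simp: cell_def field_simps)
  next
    assume "\<exists>t. l < u \<and> u < r \<and> 0 < t \<and> t < 1 \<and> y = f u + t * (g u - f u)"
    then obtain t where t: "l < u" "u < r" "0 < t" "t < 1" "y = f u + t * (g u - f u)" by auto
    have "0 < t * (g u - f u)" "t * (g u - f u) < g u - f u"
      using t less[of u] by auto
    then show "(u, y) \<in> cell l r f g"
      using t by (auto simp: cell_def)
  qed
  then have "cell l r f g = (\<lambda>(u, t). (u, f u + t * (g u - f u))) ` ({l<..<r} \<times> {0<..<1})"
    by (auto simp: image_iff set_eq_iff)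
  then show ?thesis
    by (simp add: image_image chart_def case_prod_beta)
qed

lemma Phi_closed_cell:
  "Phi ` (cell l r f g \<union> cell_rim l r f g) = chart ` ({l..r} \<times> {0..1})"
proof -
  have "(u, y) \<in> cell l r f g \<union> cell_rim l r f g \<longleftrightarrow>
      (\<exists>t. l \<le> u \<and> u \<le> r \<and> 0 \<le> t \<and> t \<le> 1 \<and> y = f u + t * (g u - f u))" (is "_ \<longleftrightarrow> ?R") for u y
  proof
    assume "(u, y) \<in> cell l r f g \<union> cell_rim l r f g"
    then have a: "l \<le> u" "u \<le> r" "f u \<le> y" "y \<le> g u"
      by (auto simp: cell_def cell_rim_def)
    show ?R
    proof (cases "f u = g u")
      case True
      \<comment> \<open>The fibre over \<open>u\<close> is a single point, so the relative height
        can be set to 0.\<close>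
      with a show ?thesis by (intro exI[of _ 0]) auto
    next
      case False
      then have "f u < g u"
        using bounds[of u] a by auto
      with a show ?thesis
        by (intro exI[of _ "(y - f u) / (g u - f u)"]) (auto simp: field_simps)
    qed
  next
    assume ?R
    then obtain t where t: "l \<le> u" "u \<le> r" "0 \<le> t" "t \<le> 1" "y = f u + t * (g u - f u)" by auto
    have "0 \<le> t * (g u - f u)" "t * (g u - f u) \<le> g u - f u"
      using t bounds[of u] mult_right_mono[of t 1 "g u - f u"] by auto
    then show "(u, y) \<in> cell l r f g \<union> cell_rim l r f g"
      using t by (auto simp: cell_def cell_rim_def)
  qed
  then have "cell l r f g \<union> cell_rim l r f g =
      (\<lambda>(u, t). (u, f u + t * (g u - f u))) ` ({l..r} \<times> {0..1})"
    by (auto simp: image_iff set_eq_iff)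
  then show ?thesis
    by (simp add: image_image chart_def case_prod_beta)
qed

lemma cell_height: "(u, y) \<in> cell l r f g \<Longrightarrow> \<bar>y\<bar> < 1"
  using bounds[of u] by (auto simp: cell_def)

text \<open>Invariance of domain applies, since \<open>chart\<close> is continuous and injective on
  the open rectangle.\<close>

lemma open_Phi_cell: "open (Phi ` cell l r f g)"
  unfolding Phi_cell
proof (rule invariance_of_domain_gen)
  show "open ({l<..<r} \<times> {0<..<1::real})"
    by (intro open_Times) auto
  show "continuous_on ({l<..<r} \<times> {0<..<1}) chart"
    by (rule continuous_on_subset[OF continuous_on_chart]) auto
  show "inj_on chart ({l<..<r} \<times> {0<..<1})"
  proof (rule inj_onI, clarsimp simp: chart_def)
    fix u t u' t' :: real
    assume *: "l < u" "u < r" "0 < t" "t < 1" "l < u'" "u' < r" "0 < t'" "t' < 1"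
      and eq: "Phi (u, f u + t * (g u - f u)) = Phi (u', f u' + t' * (g u' - f u'))"
    have "0 < t * (g u - f u)" "t * (g u - f u) < g u - f u"
      using * less[of u] by auto
    \<comment> \<open>Off the two collapsed lines \<open>Phi\<close> is injective.\<close>
    then have "\<bar>f u + t * (g u - f u)\<bar> < 1"
      using bounds[of u] * by auto
    with eq have "u = u'" "t * (g u - f u) = t' * (g u - f u)"
      by (auto simp: Phi_eq_iff)
    with less[of u] * show "u = u' \<and> t = t'" by auto
  qed
qed auto

lemma connected_Phi_cell: "connected (Phi ` cell l r f g)"
  unfolding Phi_cell
proof (rule connected_continuous_image)
  show "continuous_on ({l<..<r} \<times> {0<..<1}) chart"
    by (rule continuous_on_subset[OF continuous_on_chart]) auto
qed (intro connected_Times connected_Ioo)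

lemma Phi_cell_nonempty: "Phi ` cell l r f g \<noteq> {}"
proof -
  have "((l + r) / 2, 1 / 2) \<in> {l<..<r} \<times> {0<..<1::real}"
    using l_less_r by auto
  then show ?thesis
    unfolding Phi_cell by blast
qed

text \<open>The image of the closed rectangle is compact, hence closed; conversely, continuity sends
  the closure of the open rectangle into the closure of its image.\<close>

lemma closure_Phi_cell: "closure (Phi ` cell l r f g) = Phi ` (cell l r f g \<union> cell_rim l r f g)"
proof -
  have cl: "closure ({l<..<r} \<times> {0<..<1::real}) = {l..r} \<times> {0..1}"
    using l_less_r by (simp add: closure_Times)
  have "closed (chart ` ({l..r} \<times> {0..1}))"
    by (intro compact_imp_closed compact_continuous_image continuous_on_chart compact_Times) auto
  then have "closure (chart ` ({l<..<r} \<times> {0<..<1})) \<subseteq> chart ` ({l..r} \<times> {0..1})"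
    by (intro closure_minimal image_mono) auto
  moreover have "chart ` closure ({l<..<r} \<times> {0<..<1}) \<subseteq> closure (chart ` ({l<..<r} \<times> {0<..<1}))"
    by (rule image_closure_subset) (auto simp: cl continuous_on_chart closure_subset)
  ultimately show ?thesis
    unfolding Phi_closed_cell Phi_cell cl by blast
qed

text \<open>The rim may contain collapsed points, but the cell does not, so equal images come from
  equal points.\<close>

lemma Phi_cell_rim_disjoint: "Phi ` cell l r f g \<inter> Phi ` cell_rim l r f g = {}"
proof -
  have "Phi (u, y) \<noteq> Phi (u', y')"
    if "(u, y) \<in> cell l r f g" "(u', y') \<in> cell_rim l r f g" for u y u' y'
    using cell_height[OF that(1)] that by (auto simp: Phi_eq_iff cell_def cell_rim_def)
  then show ?thesis by fastforce
qed

lemma frontier_Phi_cell: "frontier (Phi ` cell l r f g) = Phi ` cell_rim l r f g"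
  unfolding frontier_def closure_Phi_cell interior_open[OF open_Phi_cell]
  using Phi_cell_rim_disjoint by (auto simp: image_Un)

end

section \<open>The plane graph\<close>

text \<open>The sign of the half-plane that holds the vertex \<open>w\<close>, for \<open>w\<close>
  at least \<open>2 * k\<close>.\<close>

definition side :: "nat \<Rightarrow> real" where
  "side w = (if even w then 1 else - 1)"

text \<open>The direction from \<open>p\<^sub>j\<close> to the midpoints of its gadget: right for
  the even end, left for the odd one.\<close>

definition slope :: "nat \<Rightarrow> real" where
  "slope j = (if even j then 1 else - 1)"

locale ladder =
  fixes k :: nat
  assumes k_pos: "0 < k"
begin

text \<open>
  Numbering of the vertices: \<open>j < 2k\<close> is \<open>p\<^sub>j\<close>; \<open>2k + 2i\<close> and \<open>2k + 2i + 1\<close> for \<open>i < k\<close> are the upper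
  and the lower midpoint of the \<open>i\<close>-th gadget; \<open>4k\<close> is \<open>s\<close> and \<open>4k + 1\<close> is \<open>t\<close>. So every edge has
  its smaller end among the \<open>p\<^sub>j\<close>, and the larger end lies above the axis iff its number is even.
\<close>

definition adj :: "nat \<Rightarrow> nat \<Rightarrow> bool" where
  "adj j w \<longleftrightarrow> j < 2 * k \<and> w < 4 * k + 2 \<and> (4 * k \<le> w \<or> w div 2 = k + j div 2)"

definition edges :: "nat set set" where
  "edges = {{j, w} | j w. adj j w}"

text \<open>
  The strip coordinates of the end \<open>w\<close> of the edge \<open>{j, w}\<close>. A pole has no definite first
  coordinate, so that of \<open>p\<^sub>j\<close> is taken.
\<close>

definition tip :: "nat \<Rightarrow> nat \<Rightarrow> real \<times> real" where
  "tip j w = (if 4 * k \<le> w then (real j, side w) else (2 * real (w div 2 - k) + 1 / 2, side w / 2))"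

text \<open>\<open>tip 0\<close> stands for every \<open>tip j\<close>: a midpoint has the same tip
  from both ends, and at a pole \<open>Phi\<close> collapses all first coordinates.\<close>

definition vpos :: "nat \<Rightarrow> real ^ 2" where
  "vpos v = Phi (if v < 2 * k then (real v, 0) else tip 0 v)"

text \<open>The \<open>Phi\<close>-image of the straight segment from \<open>(j, 0)\<close> to the
  tip.\<close>

definition ecurve :: "nat \<Rightarrow> nat \<Rightarrow> real \<Rightarrow> real ^ 2" where
  "ecurve j w t = Phi (real j + t * (fst (tip j w) - real j), t * snd (tip j w))"

definition ecrv :: "nat set \<Rightarrow> real \<Rightarrow> real ^ 2" where
  "ecrv e = ecurve (Min e) (Max e)"

lemma adj_less: "adj j w \<Longrightarrow> j < 2 * k \<and> 2 * k \<le> w \<and> w < 4 * k + 2"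
  unfolding adj_def by linarith

lemma edgesI: "adj j w \<Longrightarrow> {j, w} \<in> edges"
  by (auto simp: edges_def)

lemma edgesE:
  assumes "e \<in> edges"
  obtains j w where "adj j w" "e = {j, w}" "j < 2 * k" "2 * k \<le> w" "w < 4 * k + 2"
  using assms adj_less by (auto simp: edges_def)

lemma ecrv_eq: "adj j w \<Longrightarrow> ecrv {j, w} = ecurve j w"
  using adj_less[of j w] by (auto simp: ecrv_def max_def min_def)

lemma tip_pole: "4 * k \<le> w \<Longrightarrow> tip j w = (real j, side w)"
  by (simp add: tip_def)

text \<open>The midpoint at \<open>2 * (j div 2) + 1 / 2\<close> lies half a unit from either
  \<open>p\<^sub>j\<close> of the gadget.\<close>

lemma tip_inner:
  assumes "adj j w" "\<not> 4 * k \<le> w"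
  shows "tip j w = (real j + slope j / 2, side w / 2)"
proof -
  have "w div 2 - k = j div 2"
    using assms by (auto simp: adj_def)
  moreover have "2 * real (j div 2) + real (j mod 2) = real j"
    by (metis of_nat_add of_nat_mult of_nat_numeral mult_div_mod_eq)
  ultimately show ?thesis
    using assms(2) by (auto simp: tip_def slope_def mod_2_eq_odd split: if_splits)
qed

section \<open>Intersections of the edge curves\<close>

lemma ecurve_0: "adj j w \<Longrightarrow> ecurve j w 0 = vpos j"
  using adj_less[of j w] by (simp add: ecurve_def vpos_def)

lemma ecurve_1: "adj j w \<Longrightarrow> ecurve j w 1 = vpos w"
  using adj_less[of j w]
  by (auto simp: ecurve_def vpos_def tip_def Phi_eq_iff side_def)

lemma slope_cases: "slope j = 1 \<and> even j \<or> slope j = - 1 \<and> odd j"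
  by (auto simp: slope_def)

lemma side_cases: "side j = 1 \<and> even j \<or> side j = - 1 \<and> odd j"
  by (auto simp: side_def)

text \<open>In the strip a pole edge is vertical over an integer, while an inner edge leans by at
  most one half; comparing coordinates leaves only common ends. Simplicity of the arcs, injectivity
  of \<open>vpos\<close> and crossing-freeness all follow from this.\<close>

lemma ecurve_eqD:
  assumes "adj j w" "adj j' w'" and t: "0 \<le> t" "t \<le> 1" and t': "0 \<le> t'" "t' \<le> 1"
    and eq: "ecurve j w t = ecurve j' w' t'"
  shows "t = t' \<and> (j = j' \<and> w = w' \<or> t = 0 \<and> j = j' \<or> t = 1 \<and> w = w')"
proof -
  \<comment> \<open>A pole edge against an inner edge, stated for fresh variables so that it serves
    in both orders. The integers \<open>j\<close> and \<open>j'\<close> differ by less than 1, which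
    forces the inner edge to be at its start.\<close>
  have mixed: "t = 0 \<and> t' = 0 \<and> j = j'"
    if "adj j w" "adj j' w'" "0 \<le> t" "t \<le> 1" "0 \<le> t'" "t' \<le> 1" "ecurve j w t = ecurve j' w' t'"
      "4 * k \<le> w" "\<not> 4 * k \<le> w'" for j w t j' w' t'
  proof -
    have y: "t * side w = t' * (side w' / 2)"
      and u: "j = j' + t' * (slope j' / 2) \<or> \<bar>t' * (side w' / 2)\<bar> = 1"
      using that by (auto simp: ecurve_def tip_pole tip_inner Phi_eq_iff)
    have "\<bar>t' * (side w' / 2)\<bar> < 1"
      using side_cases[of w'] that by auto
    with u have u': "real j = j' + t' * (slope j' / 2)" by auto
    then have "\<bar>real j - real j'\<bar> < 1"
      using slope_cases[of j'] that by auto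
    then have "j = j'" by linarith
    with u' have "t' = 0"
      using slope_cases[of j'] by auto
    with y \<open>j = j'\<close> show ?thesis
      using side_cases[of w] by auto
  qed
  consider "4 * k \<le> w" "4 * k \<le> w'" | "4 * k \<le> w" "\<not> 4 * k \<le> w'"
    | "\<not> 4 * k \<le> w" "4 * k \<le> w'" | "\<not> 4 * k \<le> w" "\<not> 4 * k \<le> w'" by blast
  then show ?thesis
  proof cases
    case 1
    then have y: "t * side w = t' * side w'" and u: "j = j' \<or> \<bar>t * side w\<bar> = 1"
      using eq by (auto simp: ecurve_def tip_pole Phi_eq_iff)
    have "t = t' \<and> (t = 0 \<or> side w = side w')"
      using y t t' side_cases[of w] side_cases[of w'] by auto
    \<comment> \<open>Only the two poles are possible, and parity tells them apart.\<close>
    moreover have "w = w'" if "side w = side w'"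
    proof -
      have "even w = even w'"
        using that side_cases[of w] side_cases[of w'] by auto
      with 1 adj_less[OF assms(1)] adj_less[OF assms(2)] show ?thesis
        by presburger
    qed
    moreover have "t = 1 \<or> j = j'"
      using u t side_cases[of w] by auto
    ultimately show ?thesis using t by auto
  next
    case 2
    with mixed[OF assms(1,2) t t' eq] show ?thesis by simp
  next
    case 3
    with mixed[OF assms(2,1) t' t eq[symmetric]] show ?thesis by simp
  next
    case 4
    then have y: "t * (side w / 2) = t' * (side w' / 2)"
      and u: "real j + t * (slope j / 2) = j' + t' * (slope j' / 2) \<or> \<bar>t * (side w / 2)\<bar> = 1"
      using eq assms by (auto simp: ecurve_def tip_inner Phi_eq_iff)
    have "\<bar>t * (side w / 2)\<bar> < 1"
      using side_cases[of w] t by auto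
    with u have u: "real j + t * (slope j / 2) = j' + t' * (slope j' / 2)" by auto
    have tt: "t = t' \<and> (t = 0 \<or> even w = even w')"
      using y t t' side_cases[of w] side_cases[of w'] by auto
    have same: "w = w'" if "even w = even w'" "j div 2 = j' div 2"
    proof -
      have "w div 2 = w' div 2"
        using 4 that assms(1,2) by (auto simp: adj_def)
      with that(1) show ?thesis by presburger
    qed
    show ?thesis
    proof (cases "t = 0")
      case True
      with u tt show ?thesis by auto
    next
      case False
      then have ev: "even w = even w'"
        using tt by auto
      consider "even j = even j'" | "even j" "odd j'" | "odd j" "even j'" by blast
      then show ?thesis
      proof cases
        case 1
        with u tt have "j = j'"
          using slope_cases[of j] slope_cases[of j'] by auto
        with same ev tt show ?thesis by auto
      next
        case 2
        \<comment> \<open>The edges lean towards each other, so \<open>t\<close> is an integer in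
          \<open>(0, 1]\<close>: they meet at the midpoint between neighbours of one gadget.\<close>
        with u tt have tj: "t = real j' - real j"
          by (auto simp: slope_def)
        with False t have "j' = Suc j" by linarith
        with 2 same ev tt tj show ?thesis by auto
      next
        case 3
        with u tt have tj: "t = real j - real j'"
          by (auto simp: slope_def)
        with False t have "j = Suc j'" by linarith
        with 3 same ev tt tj show ?thesis by auto
      qed
    qed
  qed
qed

lemma adj_pole: "j < 2 * k \<Longrightarrow> adj j (4 * k)" "j < 2 * k \<Longrightarrow> adj j (Suc (4 * k))"
  by (auto simp: adj_def)

lemma adj_inner:
  assumes "Suc j < 2 * k" "even j"
  shows "adj j (2 * k + j)" "adj j (Suc (2 * k + j))"
    "adj (Suc j) (2 * k + j)" "adj (Suc j) (Suc (2 * k + j))"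
proof -
  obtain i where j: "j = 2 * i"
    using assms(2) by auto
  show "adj j (2 * k + j)" "adj j (Suc (2 * k + j))"
    "adj (Suc j) (2 * k + j)" "adj (Suc j) (Suc (2 * k + j))"
    using assms unfolding adj_def j by auto
qed

text \<open>Writing each vertex as an end of some edge curve reduces questions about vertices to
  \<open>ecurve_eqD\<close>.\<close>

lemma vpos_on_edge:
  assumes "v < 4 * k + 2"
  obtains j w t where "adj j w" "vpos v = ecurve j w t" "t = 0 \<and> v = j \<or> t = 1 \<and> v = w"
proof (cases "v < 2 * k")
  case True
  then show ?thesis
    using that[OF adj_pole(1)[OF True], of 0] ecurve_0[OF adj_pole(1)[OF True]] by simp
next
  case False
  \<comment> \<open>A pole is reached from \<open>p\<^sub>0\<close>, a midpoint from the even end of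
    its gadget.\<close>
  define j where "j = (if 4 * k \<le> v then 0 else 2 * (v div 2 - k))"
  have "adj j v"
    unfolding adj_def j_def using assms False k_pos by auto
  then show ?thesis
    using that[of j v 1] ecurve_1 by simp
qed

lemma vpos_on_ecurveD:
  assumes "adj j w" "v < 4 * k + 2" "0 \<le> t" "t \<le> 1" "vpos v = ecurve j w t"
  shows "v \<in> {j, w}"
proof -
  obtain j' w' t' where e': "adj j' w'" "vpos v = ecurve j' w' t'" "t' = 0 \<and> v = j' \<or> t' = 1 \<and> v = w'"
    using vpos_on_edge[OF assms(2)] by metis
  then have "0 \<le> t'" "t' \<le> 1" by auto
  from ecurve_eqD[OF assms(1) e'(1) assms(3,4) this] e' assms(5) show ?thesis by auto
qed

lemma inj_on_vpos: "inj_on vpos {..<4 * k + 2}"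
proof (rule inj_onI)
  fix v v' assume v: "v \<in> {..<4 * k + 2}" "v' \<in> {..<4 * k + 2}" and eq: "vpos v = vpos v'"
  obtain j w t where e: "adj j w" "vpos v = ecurve j w t" "t = 0 \<and> v = j \<or> t = 1 \<and> v = w"
    using vpos_on_edge[of v] v by auto
  obtain j' w' t' where e': "adj j' w'" "vpos v' = ecurve j' w' t'" "t' = 0 \<and> v' = j' \<or> t' = 1 \<and> v' = w'"
    using vpos_on_edge[of v'] v by auto
  have "0 \<le> t" "t \<le> 1" "0 \<le> t'" "t' \<le> 1" using e e' by auto
  from ecurve_eqD[OF e(1) e'(1) this] e e' eq show "v = v'" by auto
qed

lemma arc_ecurve: assumes "adj j w" shows "arc (ecurve j w)"
proof -
  have "continuous_on {0..1} (ecurve j w)"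
    unfolding ecurve_def by (intro continuous_intros)
  moreover have "inj_on (ecurve j w) {0..1}"
    using ecurve_eqD[OF assms assms] by (auto intro!: inj_onI)
  ultimately show ?thesis
    by (simp add: arc_def path_def)
qed

lemma ends_in_path_image:
  assumes "adj j w"
  shows "vpos j \<in> path_image (ecurve j w)" "vpos w \<in> path_image (ecurve j w)"
  unfolding path_image_def ecurve_0[OF assms, symmetric] ecurve_1[OF assms, symmetric] by auto

sublocale plane_graph "{..<4 * k + 2}" edges vpos ecrv
proof
  show "finite {..<4 * k + 2}" by simp
  show "inj_on vpos {..<4 * k + 2}" by (rule inj_on_vpos)
next
  fix e assume "e \<in> edges"
  then obtain j w where e: "adj j w" "e = {j, w}" "j < 2 * k" "2 * k \<le> w" "w < 4 * k + 2"
    by (rule edgesE)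
  show "e \<subseteq> {..<4 * k + 2}" "card e = 2" using e by auto
  show "arc (ecrv e)" using e by (simp add: ecrv_eq arc_ecurve)
  show "{pathstart (ecrv e), pathfinish (ecrv e)} = vpos ` e"
    using e by (simp add: ecrv_eq pathstart_def pathfinish_def ecurve_0 ecurve_1)
  show "path_image (ecrv e) \<inter> vpos ` {..<4 * k + 2} = vpos ` e"
  proof
    show "path_image (ecrv e) \<inter> vpos ` {..<4 * k + 2} \<subseteq> vpos ` e"
    proof
      fix z assume "z \<in> path_image (ecrv e) \<inter> vpos ` {..<4 * k + 2}"
      then obtain t v where "0 \<le> t" "t \<le> 1" "z = ecurve j w t" "z = vpos v" "v < 4 * k + 2"
        using e by (auto simp: ecrv_eq path_image_def)
      then show "z \<in> vpos ` e"
        using vpos_on_ecurveD[OF e(1), of v t] e(2) by auto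
    qed
    show "vpos ` e \<subseteq> path_image (ecrv e) \<inter> vpos ` {..<4 * k + 2}"
      using ends_in_path_image[OF e(1)] e by (auto simp: ecrv_eq)
  qed
  fix e' assume "e' \<in> edges" "e \<noteq> e'"
  then obtain j' w' where e': "adj j' w'" "e' = {j', w'}"
    by (metis edgesE)
  show "path_image (ecrv e) \<inter> path_image (ecrv e') \<subseteq> vpos ` (e \<inter> e')"
  proof
    fix z assume "z \<in> path_image (ecrv e) \<inter> path_image (ecrv e')"
    then obtain t t' where t: "0 \<le> t" "t \<le> 1" "0 \<le> t'" "t' \<le> 1"
      and z: "z = ecurve j w t" "z = ecurve j' w' t'"
      using e e' by (auto simp: ecrv_eq path_image_def)
    have "t = 0 \<and> j = j' \<or> t = 1 \<and> w = w'"
      using ecurve_eqD[OF e(1) e'(1) t] z \<open>e \<noteq> e'\<close> e e' by auto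
    then show "z \<in> vpos ` (e \<inter> e')"
      using z(1) ecurve_0[OF e(1)] ecurve_1[OF e(1)] e(2) e'(2) by auto
  qed
qed

section \<open>Edges as point sets in the strip\<close>

text \<open>The height \<open>side w * y\<close>, counted towards the side of \<open>w\<close>,
  replaces the curve parameter.\<close>

definition seg :: "nat \<Rightarrow> nat \<Rightarrow> (real \<times> real) set" where
  "seg j w = (if 4 * k \<le> w then {(u, y). u = real j \<and> 0 \<le> side w * y \<and> side w * y \<le> 1}
     else {(u, y). u = real j + slope j * (side w * y) \<and> 0 \<le> side w * y \<and> side w * y \<le> 1 / 2})"

lemma path_image_ecrv:
  assumes "adj j w"
  shows "path_image (ecrv {j, w}) = Phi ` seg j w"
proof -
  have "seg j w = (\<lambda>t. (real j + t * (fst (tip j w) - real j), t * snd (tip j w))) ` {0..1}"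
  proof (cases "4 * k \<le> w")
    case True
    have "(u, y) \<in> seg j w \<longleftrightarrow> (\<exists>t\<in>{0..1}. u = real j \<and> y = t * side w)" for u y
    proof
      assume "(u, y) \<in> seg j w"
      then show "\<exists>t\<in>{0..1}. u = real j \<and> y = t * side w"
        using True side_cases[of w]
        by (intro bexI[of _ "side w * y"]) (auto simp: seg_def)
    qed (use True side_cases[of w] in \<open>auto simp: seg_def\<close>)
    then show ?thesis
      using True by (auto simp: tip_pole image_iff set_eq_iff)
  next
    case False
    have "(u, y) \<in> seg j w \<longleftrightarrow> (\<exists>t\<in>{0..1}. u = real j + t * (slope j / 2) \<and> y = t * (side w / 2))" for u y
    proof
      assume "(u, y) \<in> seg j w"
      \<comment> \<open>The tip has height one half, so the parameter is twice the height.\<close>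
      then show "\<exists>t\<in>{0..1}. u = real j + t * (slope j / 2) \<and> y = t * (side w / 2)"
        using False side_cases[of w]
        by (intro bexI[of _ "2 * (side w * y)"]) (auto simp: seg_def)
    qed (use False side_cases[of w] slope_cases[of j] in \<open>auto simp: seg_def\<close>)
    then show ?thesis
      using False assms by (auto simp: tip_inner image_iff set_eq_iff)
  qed
  then show ?thesis
    unfolding ecrv_eq[OF assms] path_image_def ecurve_def by (simp add: image_image)
qed

end

section \<open>Faces and guards\<close>

text \<open>The upper path of a gadget as a graph over \<open>[j, j + 1]\<close>, with peak 1/2; the
  lower path is its negative.\<close>

definition tent :: "nat \<Rightarrow> real \<Rightarrow> real" where
  "tent j u = min (u - real j) (real j + 1 - u)"

text \<open>
  For odd \<open>j\<close> there is only one region over \<open>(j, j + 1)\<close>, that with \<open>c = 0\<close>; for even \<open>j\<close> the values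
  \<open>c = 0, 1, 2\<close> give the lower, middle and upper region of a gadget.
\<close>

definition floor_fun :: "nat \<Rightarrow> nat \<Rightarrow> real \<Rightarrow> real" where
  "floor_fun j c u = (if odd j \<or> c = 0 then - 1 else if c = 1 then - tent j u else tent j u)"

definition roof_fun :: "nat \<Rightarrow> nat \<Rightarrow> real \<Rightarrow> real" where
  "roof_fun j c u = (if odd j then 1 else if c = 0 then - tent j u else if c = 1 then tent j u else 1)"

lemma strip_cell_patch:
  assumes "c < 3"
  shows "strip_cell (real j) (real j + 1) (floor_fun j c) (roof_fun j c)"
proof
  show "continuous_on {real j..real j + 1} (floor_fun j c)"
       "continuous_on {real j..real j + 1} (roof_fun j c)"
    unfolding floor_fun_def roof_fun_def tent_def
    by (cases "odd j"; cases "c = 0"; cases "c = 1"; auto intro!: continuous_intros)+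
qed (use assms in \<open>auto simp: floor_fun_def roof_fun_def tent_def\<close>)

lemma strip_cell_const: "l < r \<Longrightarrow> strip_cell l r (\<lambda>_. - 1) (\<lambda>_. 1)"
  by unfold_locales auto

context ladder
begin

lemma seg_pole:
  "seg j (4 * k) = {(u, y). u = real j \<and> 0 \<le> y \<and> y \<le> 1}"
  "seg j (Suc (4 * k)) = {(u, y). u = real j \<and> - 1 \<le> y \<and> y \<le> 0}"
  by (auto simp: seg_def side_def)

lemma seg_inner:
  assumes "Suc j < 2 * k" "even j"
  shows "seg j (2 * k + j) = {(u, y). u = j + y \<and> 0 \<le> y \<and> y \<le> 1 / 2}"
    "seg (Suc j) (2 * k + j) = {(u, y). u = j + 1 - y \<and> 0 \<le> y \<and> y \<le> 1 / 2}"
    "seg j (Suc (2 * k + j)) = {(u, y). u = j - y \<and> - 1 / 2 \<le> y \<and> y \<le> 0}"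
    "seg (Suc j) (Suc (2 * k + j)) = {(u, y). u = j + 1 + y \<and> - 1 / 2 \<le> y \<and> y \<le> 0}"
  using assms by (auto simp: seg_def side_def slope_def)

section \<open>Four-cycles as frontiers of the bounded faces\<close>

text \<open>The graph is bipartite with the \<open>p\<^sub>j\<close> on one side, so a four-cycle
  amounts to two of them with two common neighbours.\<close>

definition cycle4 :: "nat \<Rightarrow> nat \<Rightarrow> nat \<Rightarrow> nat \<Rightarrow> bool" where
  "cycle4 j j' w w' \<longleftrightarrow> j \<noteq> j' \<and> w \<noteq> w' \<and> adj j w \<and> adj j' w \<and> adj j w' \<and> adj j' w'"

definition cycle4_image :: "nat \<Rightarrow> nat \<Rightarrow> nat \<Rightarrow> nat \<Rightarrow> (real ^ 2) set" where
  "cycle4_image j j' w w' = Phi ` (seg j w \<union> seg j' w \<union> seg j w' \<union> seg j' w')"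

lemma cycle4_bounds:
  assumes "cycle4 j j' w w'" "frontier f = cycle4_image j j' w w'"
  shows "bounded_by_four_cycle f"
proof -
  have adj: "adj j w" "adj j' w" "adj j w'" "adj j' w'" and ne: "j \<noteq> j'" "w \<noteq> w'"
    using assms(1) by (auto simp: cycle4_def)
  have "four_cycle w j w' j'"
    using adj[THEN adj_less] adj[THEN edgesI] ne
    by (auto simp: four_cycle_def insert_commute)
  moreover have "frontier f = path_image (ecrv {w, j}) \<union> path_image (ecrv {j, w'}) \<union>
                  path_image (ecrv {w', j'}) \<union> path_image (ecrv {j', w})"
    unfolding assms(2) cycle4_image_def insert_commute[of w] insert_commute[of w']
      adj[THEN path_image_ecrv] by auto
  ultimately show ?thesis
    unfolding bounded_by_four_cycle_def by blast
qed

lemma vpos_in_cycle4_image: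
  assumes "cycle4 j j' w w'" "v \<in> {j, j', w, w'}"
  shows "vpos v \<in> cycle4_image j j' w w'"
proof -
  have "vpos a \<in> Phi ` seg a b \<and> vpos b \<in> Phi ` seg a b" if "adj a b" for a b
    using ends_in_path_image[OF that] path_image_ecrv[OF that] ecrv_eq[OF that] by simp
  with assms show ?thesis
    unfolding cycle4_def cycle4_image_def image_Un by auto
qed

lemma vpos_in_cycle4_imageD:
  assumes "cycle4 j j' w w'" "v < 4 * k + 2" "vpos v \<in> cycle4_image j j' w w'"
  shows "v \<in> {j, j', w, w'}"
proof -
  have "v \<in> {a, b}" if ab: "adj a b" "vpos v \<in> Phi ` seg a b" for a b
  proof -
    have "vpos v \<in> path_image (ecurve a b)"
      using path_image_ecrv[OF ab(1)] ecrv_eq[OF ab(1)] ab(2) by simp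
    then show ?thesis
      using vpos_on_ecurveD[OF ab(1) assms(2)] by (auto simp: path_image_def)
  qed
  with assms show ?thesis
    unfolding cycle4_def cycle4_image_def image_Un by blast
qed

text \<open>The horizontal sides collapse to the poles, which already end the vertical
  sides.\<close>

lemma image_two_pole_rim:
  assumes "j < j'"
  shows "Phi ` cell_rim (real j) (real j') (\<lambda>_. - 1) (\<lambda>_. 1) = cycle4_image j j' (4 * k) (Suc (4 * k))"
proof -
  let ?S = "seg j (4 * k) \<union> seg j' (4 * k) \<union> seg j (Suc (4 * k)) \<union> seg j' (Suc (4 * k))"
  have S: "?S = {(u, y). (u = real j \<or> u = real j') \<and> - 1 \<le> y \<and> y \<le> 1}"
    by (auto simp: seg_pole)
  have sub: "?S \<subseteq> cell_rim (real j) (real j') (\<lambda>_. - 1) (\<lambda>_. 1)"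
    unfolding S using assms by (auto simp: cell_rim_def)
  have "Phi (u, y) \<in> Phi ` ?S" if "(u, y) \<in> cell_rim (real j) (real j') (\<lambda>_. - 1) (\<lambda>_. 1)" for u y
  proof (cases "u = real j \<or> u = real j'")
    case True
    then show ?thesis using that unfolding S by (auto simp: cell_rim_def)
  next
    case False
    then have "Phi (u, y) = Phi (real j, y)" "(real j, y) \<in> ?S"
      using that unfolding S by (auto simp: cell_rim_def Phi_eq_iff)
    then show ?thesis by blast
  qed
  with sub show ?thesis
    unfolding cycle4_image_def by fast
qed

lemma tent_graph:
  assumes "Suc j < 2 * k" "even j"
  shows "seg j (2 * k + j) \<union> seg (Suc j) (2 * k + j) =
      {(u, y). real j \<le> u \<and> u \<le> real j + 1 \<and> y = tent j u}"
    "seg j (Suc (2 * k + j)) \<union> seg (Suc j) (Suc (2 * k + j)) =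
      {(u, y). real j \<le> u \<and> u \<le> real j + 1 \<and> y = - tent j u}"
  unfolding seg_inner[OF assms] by (auto simp: tent_def min_def split: if_splits)

definition patch :: "nat \<Rightarrow> nat \<Rightarrow> (real ^ 2) set" where
  "patch j c = Phi ` cell (real j) (real j + 1) (floor_fun j c) (roof_fun j c)"

lemma frontier_patch:
  "c < 3 \<Longrightarrow> frontier (patch j c) = Phi ` cell_rim (real j) (real j + 1) (floor_fun j c) (roof_fun j c)"
  unfolding patch_def by (rule strip_cell.frontier_Phi_cell[OF strip_cell_patch])

lemma frontier_gap:
  assumes "odd j"
  shows "frontier (patch j 0) = cycle4_image j (Suc j) (4 * k) (Suc (4 * k))"
proof -
  have "floor_fun j 0 = (\<lambda>_. - 1)" "roof_fun j 0 = (\<lambda>_. 1)"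
    using assms by (auto simp: floor_fun_def roof_fun_def)
  then show ?thesis
    using image_two_pole_rim[of j "Suc j"] by (simp add: frontier_patch add.commute)
qed

lemma frontier_upper:
  assumes "Suc j < 2 * k" "even j"
  shows "frontier (patch j 2) = cycle4_image j (Suc j) (4 * k) (2 * k + j)"
proof -
  let ?R = "cell_rim (real j) (real j + 1) (floor_fun j 2) (roof_fun j 2)"
  let ?S = "seg j (4 * k) \<union> seg (Suc j) (4 * k) \<union> (seg j (2 * k + j) \<union> seg (Suc j) (2 * k + j))"
  have fr: "floor_fun j 2 = tent j" "roof_fun j 2 = (\<lambda>_. 1)"
    using assms by (auto simp: floor_fun_def roof_fun_def)
  have sub: "?S \<subseteq> ?R"
    unfolding seg_pole tent_graph[OF assms] fr by (auto simp: cell_rim_def tent_def)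
  have "Phi (u, y) \<in> Phi ` ?S" if "(u, y) \<in> ?R" for u y
  proof (cases "(u, y) \<in> ?S")
    \<comment> \<open>What remains of the rim is the line \<open>y = 1\<close>, which
      \<open>Phi\<close> maps to the pole \<open>s\<close>.\<close>
    case False
    then have "Phi (u, y) = Phi (real j, y)" "(real j, y) \<in> seg j (4 * k)"
      using that unfolding seg_pole tent_graph[OF assms] fr
      by (auto simp: cell_rim_def Phi_eq_iff tent_def)
    then show ?thesis by blast
  qed blast
  with sub show ?thesis
    unfolding cycle4_image_def frontier_patch[of 2, simplified] Un_assoc by fast
qed

lemma frontier_lower:
  assumes "Suc j < 2 * k" "even j"
  shows "frontier (patch j 0) = cycle4_image j (Suc j) (Suc (4 * k)) (Suc (2 * k + j))"
proof -
  let ?R = "cell_rim (real j) (real j + 1) (floor_fun j 0) (roof_fun j 0)"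
  let ?S = "seg j (Suc (4 * k)) \<union> seg (Suc j) (Suc (4 * k)) \<union>
    (seg j (Suc (2 * k + j)) \<union> seg (Suc j) (Suc (2 * k + j)))"
  have fr: "floor_fun j 0 = (\<lambda>_. - 1)" "roof_fun j 0 = (\<lambda>u. - tent j u)"
    using assms by (auto simp: floor_fun_def roof_fun_def)
  have sub: "?S \<subseteq> ?R"
    unfolding seg_pole tent_graph[OF assms] fr by (auto simp: cell_rim_def tent_def)
  have "Phi (u, y) \<in> Phi ` ?S" if "(u, y) \<in> ?R" for u y
  proof (cases "(u, y) \<in> ?S")
    \<comment> \<open>What remains of the rim is the line \<open>y = -1\<close>, which
      \<open>Phi\<close> maps to the pole \<open>t\<close>.\<close>
    case False
    then have "Phi (u, y) = Phi (real j, y)" "(real j, y) \<in> seg j (Suc (4 * k))"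
      using that unfolding seg_pole tent_graph[OF assms] fr
      by (auto simp: cell_rim_def Phi_eq_iff tent_def)
    then show ?thesis by blast
  qed blast
  with sub show ?thesis
    unfolding cycle4_image_def frontier_patch[of 0, simplified] Un_assoc by fast
qed

lemma frontier_lens:
  assumes "Suc j < 2 * k" "even j"
  shows "frontier (patch j 1) = cycle4_image j (Suc j) (2 * k + j) (Suc (2 * k + j))"
proof -
  have "floor_fun j 1 = (\<lambda>u. - tent j u)" "roof_fun j 1 = tent j"
    using assms by (auto simp: floor_fun_def roof_fun_def)
  \<comment> \<open>The tent vanishes at both ends, so the vertical sides are single points of the
    graphs.\<close>
  then have "cell_rim (real j) (real j + 1) (floor_fun j 1) (roof_fun j 1) =
      (seg j (2 * k + j) \<union> seg (Suc j) (2 * k + j)) \<union>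
      (seg j (Suc (2 * k + j)) \<union> seg (Suc j) (Suc (2 * k + j)))"
    unfolding tent_graph[OF assms] by (auto simp: cell_rim_def tent_def)
  then show ?thesis
    by (simp add: frontier_patch cycle4_image_def Un_assoc)
qed

section \<open>The outer face\<close>

definition width :: real where "width = real (2 * k - 1)"

lemma width_pos: "0 < width"
  using k_pos by (simp add: width_def)

lemma j_le_width: "j < 2 * k \<Longrightarrow> real j \<le> width"
  by (simp add: width_def)

text \<open>A closed triangle with corners \<open>s\<close>, \<open>t\<close> and the last axis
  vertex; \<open>p\<^sub>0\<close> lies on the side between the poles.\<close>

definition kite :: "(real ^ 2) set" where
  "kite = Phi ` ({0..width} \<times> {- 1..1})"

lemma kite_eq_closure: "kite = closure (Phi ` cell 0 width (\<lambda>_. - 1) (\<lambda>_. 1))"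
proof -
  have "{0..width} \<times> {- 1..1} = cell 0 width (\<lambda>_. - 1) (\<lambda>_. 1) \<union> cell_rim 0 width (\<lambda>_. - 1) (\<lambda>_. 1)"
    by (auto simp: cell_def cell_rim_def)
  then show ?thesis
    by (simp add: kite_def strip_cell.closure_Phi_cell[OF strip_cell_const[OF width_pos]])
qed

text \<open>The image is an open triangle, that is, an intersection of three open
  half-planes.\<close>

lemma convex_Phi_cell_const:
  assumes "0 < r"
  shows "convex (Phi ` cell 0 r (\<lambda>_. - 1) (\<lambda>_. 1))"
proof -
  have "Phi ` cell 0 r (\<lambda>_. - 1) (\<lambda>_. 1) = {z. axis 1 1 \<bullet> z > 0} \<inter>
      {z. (axis 1 1 + r *\<^sub>R axis 2 1) \<bullet> z < r} \<inter> {z. (axis 1 1 - r *\<^sub>R axis 2 1) \<bullet> z < r}"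
    (is "_ = ?C")
  proof
    show "Phi ` cell 0 r (\<lambda>_. - 1) (\<lambda>_. 1) \<subseteq> ?C"
    proof clarify
      fix u y assume "(u, y) \<in> cell 0 r (\<lambda>_. - 1) (\<lambda>_. 1)"
      then have uy: "0 < u" "u < r" "\<bar>y\<bar> < 1" by (auto simp: cell_def)
      then have "u * (1 - \<bar>y\<bar>) < r * (1 - \<bar>y\<bar>)" "0 < u * (1 - \<bar>y\<bar>)" by auto
      moreover have "r * y \<le> r * \<bar>y\<bar>" "- (r * y) \<le> r * \<bar>y\<bar>"
        using assms mult_left_mono[of "- y" "\<bar>y\<bar>" r] by (auto intro: mult_left_mono)
      ultimately show "Phi (u, y) \<in> ?C"
        by (auto simp: inner_add_left inner_diff_left inner_axis' algebra_simps)
    qed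
    show "?C \<subseteq> Phi ` cell 0 r (\<lambda>_. - 1) (\<lambda>_. 1)"
    proof
      fix z assume "z \<in> ?C"
      then have z: "0 < z $ 1" "z $ 1 + r * z $ 2 < r" "z $ 1 - r * z $ 2 < r"
        by (auto simp: inner_add_left inner_diff_left inner_axis')
      then have z': "z $ 1 < r * (1 - \<bar>z $ 2\<bar>)"
        by (auto simp: abs_if algebra_simps)
      with z(1) have "0 < r * (1 - \<bar>z $ 2\<bar>)" by linarith
      then have lt: "\<bar>z $ 2\<bar> < 1"
        using assms by (simp add: zero_less_mult_iff)
      have "z = Phi (z $ 1 / (1 - \<bar>z $ 2\<bar>), z $ 2)"
        using lt by (simp add: vec_eq_iff forall_2)
      moreover have "(z $ 1 / (1 - \<bar>z $ 2\<bar>), z $ 2) \<in> cell 0 r (\<lambda>_. - 1) (\<lambda>_. 1)"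
        using z(1) z' lt by (auto simp: cell_def field_simps)
      ultimately show "z \<in> Phi ` cell 0 r (\<lambda>_. - 1) (\<lambda>_. 1)" by (rule image_eqI)
    qed
  qed
  then show ?thesis
    by (simp only:) (intro convex_Int convex_halfspace_gt convex_halfspace_lt)
qed

text \<open>A convex set and its closure have the same interior, hence here the same frontier, and
  complements share frontiers.\<close>

lemma frontier_outer: "frontier (- kite) = cycle4_image 0 (2 * k - 1) (4 * k) (Suc (4 * k))"
proof -
  interpret strip_cell 0 width "\<lambda>_. - 1" "\<lambda>_. 1"
    by (rule strip_cell_const[OF width_pos])
  have "frontier (closure (Phi ` cell 0 width (\<lambda>_. - 1) (\<lambda>_. 1))) =
      frontier (Phi ` cell 0 width (\<lambda>_. - 1) (\<lambda>_. 1))"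
    unfolding frontier_def closure_closure
      convex_interior_closure[OF convex_Phi_cell_const[OF width_pos]] ..
  then have "frontier (- kite) = frontier (Phi ` cell 0 width (\<lambda>_. - 1) (\<lambda>_. 1))"
    by (simp add: kite_eq_closure frontier_complement)
  also have "\<dots> = cycle4_image 0 (2 * k - 1) (4 * k) (Suc (4 * k))"
    unfolding frontier_Phi_cell using image_two_pole_rim[of 0 "2 * k - 1"] k_pos
    by (simp add: width_def)
  finally show ?thesis .
qed

lemma compact_kite: "compact kite"
  unfolding kite_def
  by (intro compact_continuous_image compact_Times continuous_intros) auto

lemma connected_outer: "connected (- kite)"
proof -
  have "convex kite"
    unfolding kite_eq_closure by (intro convex_closure convex_Phi_cell_const width_pos)
  then show ?thesis
    by (intro connected_complement_bounded_convex compact_imp_bounded compact_kite) auto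
qed

lemma outer_nonempty: "- kite \<noteq> {}"
  using compact_imp_bounded[OF compact_kite] not_bounded_UNIV by (metis Compl_empty_eq double_compl)

section \<open>Enumeration of the faces\<close>

text \<open>Three patches for each of the \<open>k\<close> gadgets and one for each of the
  \<open>k - 1\<close> gaps; with the outer face this makes \<open>4 * k\<close> faces.\<close>

definition indices :: "(nat \<times> nat) set" where
  "indices = {(j, c). Suc j < 2 * k \<and> c < (if even j then 3 else 1)}"

lemma indices_less: "(j, c) \<in> indices \<Longrightarrow> Suc j < 2 * k \<and> c < 3"
  by (auto simp: indices_def split: if_splits)

lemma drawing_eq: "drawing = (\<Union>(j, w)\<in>{(j, w). adj j w}. Phi ` seg j w)" (is "_ = ?U")
proof (rule equalityI)
  have seg: "Phi ` seg j w \<subseteq> ?U" if "adj j w" for j w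
    using that by blast
  show "drawing \<subseteq> ?U"
    unfolding drawing_def
  proof (intro Un_least UN_least image_subsetI)
    fix v assume "v \<in> {..<4 * k + 2}"
    then obtain j w t where e: "adj j w" "vpos v = ecurve j w t" "t = 0 \<and> v = j \<or> t = 1 \<and> v = w"
      using vpos_on_edge[of v] by auto
    then have "vpos v \<in> Phi ` seg j w"
      using ends_in_path_image[OF e(1)]
      unfolding path_image_ecrv[OF e(1), symmetric] ecrv_eq[OF e(1)] by auto
    with seg[OF e(1)] show "vpos v \<in> ?U" by (rule subsetD)
  next
    fix e assume "e \<in> edges"
    then obtain j w where "adj j w" "e = {j, w}" by (rule edgesE)
    then show "path_image (ecrv e) \<subseteq> ?U"
      using seg path_image_ecrv by simp
  qed
  have "Phi ` seg j w \<subseteq> drawing" if "adj j w" for j w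
    using edgesI[OF that] unfolding path_image_ecrv[OF that, symmetric] drawing_def by blast
  then show "?U \<subseteq> drawing"
    by (intro UN_least) auto
qed

text \<open>For disjointness it only matters whether a point lies on a vertical line over an integer
  or on the graph of a tent up to sign.\<close>

lemma seg_cases:
  assumes "adj j w" "(u, y) \<in> seg j w"
  obtains "u = real j" "\<bar>y\<bar> \<le> 1" "j < 2 * k"
    | i where "Suc i < 2 * k" "even i" "\<bar>y\<bar> = tent i u" "real i \<le> u" "u \<le> real i + 1"
proof (cases "4 * k \<le> w")
  case True
  then show ?thesis
    using assms that(1) side_cases[of w] by (auto simp: seg_def adj_def)
next
  case False
  then have uy: "u = real j + slope j * \<bar>y\<bar>" "\<bar>y\<bar> \<le> 1 / 2"
    using assms(2) side_cases[of w] by (auto simp: seg_def)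
  have j: "j < 2 * k" using assms(1) adj_less by blast
  show ?thesis
  proof (cases "even j")
    case True
    then have "Suc j < 2 * k" using j by presburger
    then show ?thesis
      using that(2)[of j] True uy by (auto simp: slope_def tent_def)
  next
    case False
    \<comment> \<open>The gadget of an odd \<open>j\<close> starts at its predecessor.\<close>
    then obtain i where i: "j = Suc i" "even i" by (cases j) auto
    then show ?thesis
      using that(2)[of i] uy j by (auto simp: slope_def tent_def)
  qed
qed

lemma drawing_subset_kite: "drawing \<subseteq> kite"
proof -
  have "(u, y) \<in> {0..width} \<times> {- 1..1}" if "adj j w" "(u, y) \<in> seg j w" for j w u y
    using that
  proof (cases rule: seg_cases)
    case 1
    then show ?thesis using j_le_width by auto
  next
    case (2 i)
    then show ?thesis using j_le_width[of "Suc i"] by (auto simp: tent_def)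
  qed
  then show ?thesis
    unfolding drawing_eq kite_def by fast
qed

lemma patch_subset_kite: "(j, c) \<in> indices \<Longrightarrow> patch j c \<subseteq> kite"
  unfolding patch_def kite_def
  using indices_less[of j c] j_le_width[of "Suc j"] strip_cell.cell_height[OF strip_cell_patch[of c j]]
  by (fastforce simp: cell_def intro!: image_mono)

lemma patch_disjoint_drawing:
  assumes "(j, c) \<in> indices"
  shows "patch j c \<inter> drawing = {}"
proof -
  have c: "c < 3" using indices_less[OF assms] by simp
  have "Phi (u, y) \<noteq> Phi (u', y')"
    if uy: "(u, y) \<in> cell (real j) (real j + 1) (floor_fun j c) (roof_fun j c)"
      and e: "adj j' w" "(u', y') \<in> seg j' w" for u y u' y' j' w
  proof
    assume "Phi (u, y) = Phi (u', y')"
    then have e': "(u, y) \<in> seg j' w"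
      using strip_cell.cell_height[OF strip_cell_patch[OF c] uy] e(2) by (auto simp: Phi_eq_iff)
    have u: "real j < u" "u < real j + 1"
      using uy by (auto simp: cell_def)
    from e(1) e' show False
    proof (cases rule: seg_cases)
      case 1
      with u have "real j < real j'" "real j' < real (Suc j)" by auto
      then show False unfolding of_nat_less_iff by simp
    next
      case (2 i)
      with u have "i = j" by linarith
      with 2 uy assms show False
        by (auto simp: cell_def floor_fun_def roof_fun_def indices_def split: if_splits)
    qed
  qed
  then show ?thesis
    unfolding drawing_eq patch_def by fast
qed

text \<open>The integer part of \<open>u\<close> selects the strip, and comparing \<open>y\<close>
  with the tent and its negative selects the patch; integral \<open>u\<close> and heights 1 and -1
  belong to pole edges.\<close>

lemma kite_subset: "kite \<subseteq> drawing \<union> (\<Union>(j, c)\<in>indices. patch j c)"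
proof -
  have "Phi (u, y) \<in> drawing \<union> (\<Union>(j, c)\<in>indices. patch j c)"
    if uy: "0 \<le> u" "u \<le> width" "- 1 \<le> y" "y \<le> 1" for u y
  proof -
    have segI: "Phi (u', y') \<in> drawing" if "adj j w" "(u', y') \<in> seg j w" for j w u' y'
      using that unfolding drawing_eq by blast
    have poleI: "Phi (real j, y) \<in> drawing" if "j < 2 * k" for j
      using segI[OF adj_pole(1)[OF that], of "real j" y] segI[OF adj_pole(2)[OF that], of "real j" y] uy
      by (cases "0 \<le> y") (auto simp: seg_pole)
    have patchI: "Phi (u, y) \<in> (\<Union>(j, c)\<in>indices. patch j c)"
      if "(j, c) \<in> indices" "(u, y) \<in> cell (real j) (real j + 1) (floor_fun j c) (roof_fun j c)" for j c
      using that unfolding patch_def by blast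
    define j where "j = nat \<lfloor>u\<rfloor>"
    have j: "real j \<le> u" "u < real j + 1"
      using uy(1) unfolding j_def by linarith+
    then have j2k: "j < 2 * k"
      using uy(2) k_pos unfolding width_def by linarith
    consider "\<bar>y\<bar> = 1" | "u = real j" | "\<bar>y\<bar> < 1" "real j < u"
      using uy j by linarith
    then show ?thesis
    proof cases
      case 1
      then have "Phi (u, y) = Phi (real 0, y)"
        by (simp add: Phi_eq_iff)
      then show ?thesis using poleI[of 0] k_pos by simp
    next
      case 2
      then show ?thesis using poleI[OF j2k] by simp
    next
      case 3
      then have y: "- 1 < y" "y < 1" by linarith+
      \<comment> \<open>Since \<open>u\<close> exceeds \<open>j\<close> strictly and is at most
        \<open>2 * k - 1\<close>, another axis vertex lies to the right.\<close>
      have Suc_j: "Suc j < 2 * k"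
        using 3(2) uy(2) k_pos unfolding width_def by linarith
      show ?thesis
      proof (cases "odd j")
        case True
        then have "(j, 0) \<in> indices" using Suc_j by (simp add: indices_def)
        then show ?thesis
          using patchI[of j 0] True 3 y j by (auto simp: cell_def floor_fun_def roof_fun_def)
      next
        case False
        then have ev: "even j" by simp
        have ind: "(j, 0) \<in> indices" "(j, 1) \<in> indices" "(j, 2) \<in> indices"
          using Suc_j ev by (simp_all add: indices_def)
        have graphs: "Phi (u, y) \<in> drawing" if "y = tent j u \<or> y = - tent j u"
        proof -
          have "(u, y) \<in> (seg j (2 * k + j) \<union> seg (Suc j) (2 * k + j)) \<union>
              (seg j (Suc (2 * k + j)) \<union> seg (Suc j) (Suc (2 * k + j)))"
            unfolding tent_graph[OF Suc_j ev] using that j by auto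
          then show ?thesis
            using adj_inner[OF Suc_j ev, THEN segI, of u y] by blast
        qed
        consider "y = tent j u \<or> y = - tent j u" | "y < - tent j u" | "- tent j u < y" "y < tent j u"
          | "tent j u < y"
          by linarith
        then show ?thesis
        proof cases
          case 1
          with graphs show ?thesis by blast
        next
          case 2
          then show ?thesis
            using patchI[OF ind(1)] 3 y j ev by (auto simp: cell_def floor_fun_def roof_fun_def)
        next
          case c: 3
          then show ?thesis
            using patchI[OF ind(2)] 3 y j ev by (auto simp: cell_def floor_fun_def roof_fun_def)
        next
          case 4
          then show ?thesis
            using patchI[OF ind(3)] 3 y j ev by (auto simp: cell_def floor_fun_def roof_fun_def)
        qed
      qed
    qed
  qed
  moreover have "\<exists>u y. z = Phi (u, y) \<and> 0 \<le> u \<and> u \<le> width \<and> - 1 \<le> y \<and> y \<le> 1"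
    if "z \<in> kite" for z
    using that unfolding kite_def by (auto; blast)
  ultimately show ?thesis by blast
qed

lemma patches_disjoint:
  assumes "(j, c) \<in> indices" "(j', c') \<in> indices" "(j, c) \<noteq> (j', c')"
  shows "patch j c \<inter> patch j' c' = {}"
proof -
  have "Phi (u, y) \<noteq> Phi (u', y')"
    if uy: "(u, y) \<in> cell (real j) (real j + 1) (floor_fun j c) (roof_fun j c)"
      and uy': "(u', y') \<in> cell (real j') (real j' + 1) (floor_fun j' c') (roof_fun j' c')"
    for u y u' y'
  proof
    assume "Phi (u, y) = Phi (u', y')"
    moreover have "c < 3" using indices_less[OF assms(1)] by simp
    ultimately have [simp]: "u' = u" "y' = y"
      using strip_cell.cell_height[OF strip_cell_patch uy] by (auto simp: Phi_eq_iff)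
    have "real j < real j' + 1" "real j' < real j + 1"
      using uy uy' by (auto simp: cell_def)
    then have [simp]: "j' = j" by linarith
    \<comment> \<open>Positivity of the tent separates the three patches of one gadget.\<close>
    have u: "0 < tent j u"
      using uy by (auto simp: cell_def tent_def)
    show False
      using uy uy' u assms
      by (auto simp: cell_def floor_fun_def roof_fun_def indices_def split: if_splits)
  qed
  then show ?thesis
    unfolding patch_def by fast
qed

lemma faces_eq: "faces = insert (- kite) ((\<lambda>(j, c). patch j c) ` indices)"
  unfolding faces_def
proof (rule components_open_partition)
  show "\<Union>(insert (- kite) ((\<lambda>(j, c). patch j c) ` indices)) = - drawing"
  proof -
    have "(\<Union>(j, c)\<in>indices. patch j c) \<subseteq> kite - drawing"
      using patch_subset_kite patch_disjoint_drawing by blast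
    with drawing_subset_kite kite_subset show ?thesis by auto
  qed
next
  fix X assume "X \<in> insert (- kite) ((\<lambda>(j, c). patch j c) ` indices)"
  then consider "X = - kite" | j c where "(j, c) \<in> indices" "X = patch j c" by auto
  then have "open X \<and> connected X \<and> X \<noteq> {}"
  proof cases
    case 1
    then show ?thesis
      using connected_outer outer_nonempty compact_imp_closed[OF compact_kite]
      by (auto simp: open_closed)
  next
    case (2 j c)
    interpret strip_cell "real j" "real j + 1" "floor_fun j c" "roof_fun j c"
      using indices_less[OF 2(1)] by (intro strip_cell_patch) simp
    show ?thesis
      unfolding 2(2) patch_def
      using open_Phi_cell connected_Phi_cell Phi_cell_nonempty by blast
  qed
  then show "open X" "connected X" "X \<noteq> {}" by auto
next
  fix X Y
  assume X: "X \<in> insert (- kite) ((\<lambda>(j, c). patch j c) ` indices)"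
    and Y: "Y \<in> insert (- kite) ((\<lambda>(j, c). patch j c) ` indices)" and "X \<noteq> Y"
  have outer: "- kite \<inter> patch j c = {}" if "(j, c) \<in> indices" for j c
    using patch_subset_kite[OF that] by blast
  consider "X = - kite" | j c where "(j, c) \<in> indices" "X = patch j c"
    using X by auto
  then show "X \<inter> Y = {}"
  proof cases
    case 1
    with Y \<open>X \<noteq> Y\<close> outer show ?thesis by auto
  next
    case (2 j c)
    consider "Y = - kite" | j' c' where "(j', c') \<in> indices" "Y = patch j' c'"
      using Y by auto
    then show ?thesis
    proof cases
      case 1
      then show ?thesis
        using outer[OF 2(1)] unfolding 2(2) by (metis Int_commute)
    next
      case (2 j' c')
      with \<open>X = patch j c\<close> \<open>X \<noteq> Y\<close> have "(j, c) \<noteq> (j', c')" by auto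
      then show ?thesis
        using patches_disjoint[OF \<open>(j, c) \<in> indices\<close> 2(1)] \<open>X = patch j c\<close> 2(2) by simp
    qed
  qed
qed

text \<open>The last alternative is what the guard set needs: each face has \<open>s\<close> or an
  even axis vertex on its boundary.\<close>

lemma face_cycle4:
  assumes "f \<in> faces"
  obtains j j' w w' where "cycle4 j j' w w'" "frontier f = cycle4_image j j' w w'" "w = 4 * k \<or> even j"
proof -
  consider "f = - kite" | j c where "(j, c) \<in> indices" "f = patch j c"
    using assms unfolding faces_eq by auto
  then show ?thesis
  proof cases
    case 1
    then show ?thesis
      using that[of 0 "2 * k - 1" "4 * k" "Suc (4 * k)"] frontier_outer k_pos
      by (auto simp: cycle4_def adj_pole)
  next
    case (2 j c)
    then have j: "Suc j < 2 * k" using indices_less by blast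
    show ?thesis
    proof (cases "odd j")
      case True
      then have "f = patch j 0" using 2 by (simp add: indices_def)
      then show ?thesis
        using that[of j "Suc j" "4 * k" "Suc (4 * k)"] frontier_gap True j
        by (auto simp: cycle4_def adj_pole)
    next
      case False
      then have ev: "even j" by simp
      have "c = 0 \<or> c = 1 \<or> c = 2"
        using indices_less[OF 2(1)] by auto
      then show ?thesis
        using that[of j "Suc j" "Suc (4 * k)" "Suc (2 * k + j)"] that[of j "Suc j" "4 * k" "2 * k + j"]
          that[of j "Suc j" "2 * k + j" "Suc (2 * k + j)"] 2(2) j ev
          frontier_lower[OF j ev] frontier_lens[OF j ev] frontier_upper[OF j ev]
          adj_inner[OF j ev]
        by (auto simp: cycle4_def adj_pole)
    qed
  qed
qed

sublocale quadrangulation "{..<4 * k + 2}" edges vpos ecrv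
proof
  fix f assume "f \<in> faces"
  then show "bounded_by_four_cycle f"
    using face_cycle4 cycle4_bounds by metis
qed

section \<open>Edge guard sets\<close>

lemma exists_guard_set: "\<exists>\<Gamma>. edge_guard_set \<Gamma> \<and> card \<Gamma> = k"
proof (intro exI conjI)
  have "inj_on (\<lambda>i. {2 * i, 4 * k}) {..<k}"
    by (auto simp: inj_on_def doubleton_eq_iff)
  then show "card ((\<lambda>i. {2 * i, 4 * k}) ` {..<k}) = k"
    by (simp add: card_image)
  show "edge_guard_set ((\<lambda>i. {2 * i, 4 * k}) ` {..<k})"
    unfolding edge_guard_set_def
  proof (intro conjI ballI)
    show "(\<lambda>i. {2 * i, 4 * k}) ` {..<k} \<subseteq> edges"
      by (auto intro!: edgesI adj_pole)
    fix f assume "f \<in> faces"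
    then obtain j j' w w' where c: "cycle4 j j' w w'" "frontier f = cycle4_image j j' w w'"
      and "w = 4 * k \<or> even j" by (rule face_cycle4)
    then consider "w = 4 * k" | i where "j = 2 * i" by blast
    then show "\<exists>e\<in>(\<lambda>i. {2 * i, 4 * k}) ` {..<k}. guards e f"
    proof cases
      case 1
      then show ?thesis
        using vpos_in_cycle4_image[OF c(1), of w] k_pos
        by (intro bexI[of _ "{2 * 0, 4 * k}"]) (auto simp: guards_def c(2))
    next
      case (2 i)
      then have "i < k"
        using c(1) adj_less[of j w] by (auto simp: cycle4_def)
      with 2 show ?thesis
        using vpos_in_cycle4_image[OF c(1), of j]
        by (intro bexI[of _ "{2 * i, 4 * k}"]) (auto simp: guards_def c(2))
    qed
  qed
qed

text \<open>Sending an edge to the gadget of its axis end maps \<open>\<Gamma>\<close> onto all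
  \<open>k\<close> gadgets, because the lens of each gadget has to be guarded.\<close>

lemma guard_set_lower_bound:
  assumes "edge_guard_set \<Gamma>"
  shows "k \<le> card \<Gamma>"
proof -
  have sub: "\<Gamma> \<subseteq> edges" and guard: "\<And>f. f \<in> faces \<Longrightarrow> \<exists>e\<in>\<Gamma>. guards e f"
    using assms unfolding edge_guard_set_def by blast+
  have "edges \<subseteq> Pow {..<4 * k + 2}"
    using edge_subset by blast
  then have "finite \<Gamma>"
    using sub by (meson finite_Pow_iff finite_lessThan finite_subset)
  moreover have "{..<k} \<subseteq> (\<lambda>e. Min e div 2) ` \<Gamma>"
  proof
    fix i assume "i \<in> {..<k}"
    define j where "j = 2 * i"
    have j: "Suc j < 2 * k" "even j"
      using \<open>i \<in> {..<k}\<close> by (auto simp: j_def)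
    have c: "cycle4 j (Suc j) (2 * k + j) (Suc (2 * k + j))"
      using adj_inner[OF j] by (simp add: cycle4_def)
    have "(j, 1) \<in> indices" using j by (simp add: indices_def)
    then have "patch j 1 \<in> faces"
      unfolding faces_eq by force
    then obtain e v where e: "e \<in> \<Gamma>" "v \<in> e" "vpos v \<in> frontier (patch j 1)"
      using guard unfolding guards_def by blast
    then have "e \<in> edges" using sub by blast
    then obtain a w where aw: "adj a w" "e = {a, w}" "a < 2 * k" "2 * k \<le> w" "w < 4 * k + 2"
      by (rule edgesE)
    then have "v < 4 * k + 2" using e(2) by auto
    then have "v \<in> {j, Suc j, 2 * k + j, Suc (2 * k + j)}"
      using vpos_in_cycle4_imageD[OF c] e(3) frontier_lens[OF j] by simp
    \<comment> \<open>If \<open>v\<close> is a midpoint, adjacency places \<open>a\<close> in the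
      same gadget; if \<open>v\<close> is on the axis, it is \<open>a\<close> itself.\<close>
    then have "a div 2 = i"
      using aw e(2) j unfolding adj_def j_def by auto
    moreover have "Min e = a" using aw by (simp add: min_def)
    ultimately show "i \<in> (\<lambda>e. Min e div 2) ` \<Gamma>" using e(1) by force
  qed
  ultimately show ?thesis
    using surj_card_le by fastforce
qed

end

theorem theorem1:
  fixes k :: nat
  assumes "k > 0"
  shows "\<exists>(V :: nat set) (E :: nat set set) (pos :: nat \<Rightarrow> real ^ 2)
            (crv :: nat set \<Rightarrow> real \<Rightarrow> real ^ 2).
           quadrangulation V E pos crv \<and>
           card V = 4 * k + 2 \<and>
           real k = (real (card V) - 2) / 4 \<and>
           (\<exists>\<Gamma>. plane_graph.edge_guard_set V E pos crv \<Gamma> \<and> card \<Gamma> = k) \<and>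
           (\<forall>\<Gamma>. plane_graph.edge_guard_set V E pos crv \<Gamma> \<longrightarrow> k \<le> card \<Gamma>)"
proof -
  interpret ladder k by (rule ladder.intro[OF assms])
  show ?thesis
    using quadrangulation_axioms exists_guard_set guard_set_lower_bound
    by (intro exI[of _ "{..<4 * k + 2}"] exI[of _ edges] exI[of _ vpos] exI[of _ ecrv]) auto
qed

end
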